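(* Let $\mathbb{F}$ be an ordered subfield of $\mathbb{R}$. Then $\mathbb{F}$ is complete if and only if for all $a,b\in\mathbb{F}$ with $a<b$, every differentiable function $f:[a,b]_{\mathbb{F}}\to\mathbb{F}$ whose derivative $f':[a,b]_{\mathbb{F}}\to\mathbb{F}$ is uniformly continuous is uniformly differentiable on $[a,b]_{\mathbb{F}}$.
   Context: $\mathbb{F}$ denotes a subfield of $\mathbb{R}$ with the induced order, and $\mathbb{F}^+$ is the set of its positive elements. "$\mathbb{F}$ is complete" means every nonempty subset of $\mathbb{F}$ bounded above has a supremum in $\mathbb{F}$; equivalently, $\mathbb{F}=\mathbb{R}$. For $a,b\in\mathbb{F}$, $a<b$, write $[a,b]_{\mathbb{F}}=[a,b]\cap\mathbb{F}$, where $[a,b]$ is the real interval. Uniform continuity is in the usual $\epsilon$-$\delta$ sense with $\epsilon,\delta\in\mathbb{F}^+$. For $f:[a,b]_{\mathbb{F}}\to\mathbb{F}$ and $x\neq c$ in $[a,b]_{\mathbb{F}}$, put $D_c[f](x)=\frac{f(x)-f(c)}{x-c}$. $f$ is differentiable at $c\in[a,b]_{\mathbb{F}}$ with derivative $f'(c)=m\in\mathbb{F}$ if for every $\epsilon\in\mathbb{F}^+$ there is $\delta\in\mathbb{F}^+$ such that $|D_c[f](x)-m|<\epsilon$ for every $x\in[a,b]_{\mathbb{F}}$ with $0<|x-c|<\delta$; $f$ is differentiable if it is differentiable at every $c\in[a,b]_{\mathbb{F}}$. $f$ is uniformly differentiable on $[a,b]_{\mathbb{F}}$ if there exists a function $g:[a,b]_{\mathbb{F}}\to\mathbb{F}$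 such that for every $\epsilon\in\mathbb{F}^+$ there is a $\delta\in\mathbb{F}^+$ with $|D_y[f](x)-g(y)|<\epsilon$ for all $x,y\in[a,b]_{\mathbb{F}}$ with $0<|x-y|<\delta$ (then $g=f'$). *)

theory Defs
  imports Complex_Main "HOL-Library.FuncSet"
begin

definition real_subfield :: "real set \<Rightarrow> bool" where
  "real_subfield F \<longleftrightarrow>
     0 \<in> F \<and> 1 \<in> F \<and>
     (\<forall>x\<in>F. \<forall>y\<in>F. x + y \<in> F \<and> x * y \<in> F) \<and>
     (\<forall>x\<in>F. - x \<in> F) \<and>
     (\<forall>x\<in>F. x \<noteq> 0 \<longrightarrow> inverse x \<in> F)"

definition positives :: "real set \<Rightarrow> real set" where
  "positives F = {x \<in> F. 0 < x}"

text \<open>Upper bounds and least upper bounds are taken inside \<open>F\<close>: the supremum of \<open>S\<close> is the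
  least element among the upper bounds of \<open>S\<close> belonging to \<open>F\<close>, not the supremum in the reals.\<close>

definition upper_bound_in :: "real set \<Rightarrow> real set \<Rightarrow> real \<Rightarrow> bool" where
  "upper_bound_in F S u \<longleftrightarrow> u \<in> F \<and> (\<forall>x\<in>S. x \<le> u)"

definition supremum_in :: "real set \<Rightarrow> real set \<Rightarrow> real \<Rightarrow> bool" where
  "supremum_in F S s \<longleftrightarrow> upper_bound_in F S s \<and> (\<forall>u. upper_bound_in F S u \<longrightarrow> s \<le> u)"

definition order_complete :: "real set \<Rightarrow> bool" where
  "order_complete F \<longleftrightarrow>
     (\<forall>S. S \<subseteq> F \<and> S \<noteq> {} \<and> (\<exists>u. upper_bound_in F S u) \<longrightarrow> (\<exists>s. supremum_in F S s))"

definition interval_in :: "real set \<Rightarrow> real \<Rightarrow> real \<Rightarrow> real set" where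
  "interval_in F a b = {a..b} \<inter> F"

text \<open>Functions from \<open>interval_in F a b\<close> to \<open>F\<close> are total functions on the reals mapping
  \<open>interval_in F a b\<close> into \<open>F\<close>; the notions below only inspect their values there.\<close>

definition diff_quot :: "(real \<Rightarrow> real) \<Rightarrow> real \<Rightarrow> real \<Rightarrow> real" where
  "diff_quot f c x = (f x - f c) / (x - c)"

definition has_derivative_in ::
    "real set \<Rightarrow> real \<Rightarrow> real \<Rightarrow> (real \<Rightarrow> real) \<Rightarrow> real \<Rightarrow> real \<Rightarrow> bool" where
  "has_derivative_in F a b f c m \<longleftrightarrow>
     m \<in> F \<and>
     (\<forall>\<epsilon>\<in>positives F. \<exists>\<delta>\<in>positives F. \<forall>x\<in>interval_in F a b.
        0 < \<bar>x - c\<bar> \<and> \<bar>x - c\<bar> < \<delta> \<longrightarrow> \<bar>diff_quot f c x - m\<bar> < \<epsilon>)"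

definition uniformly_continuous_in ::
    "real set \<Rightarrow> real \<Rightarrow> real \<Rightarrow> (real \<Rightarrow> real) \<Rightarrow> bool" where
  "uniformly_continuous_in F a b g \<longleftrightarrow>
     (\<forall>\<epsilon>\<in>positives F. \<exists>\<delta>\<in>positives F. \<forall>x\<in>interval_in F a b. \<forall>y\<in>interval_in F a b.
        \<bar>x - y\<bar> < \<delta> \<longrightarrow> \<bar>g x - g y\<bar> < \<epsilon>)"

definition uniformly_differentiable_in ::
    "real set \<Rightarrow> real \<Rightarrow> real \<Rightarrow> (real \<Rightarrow> real) \<Rightarrow> bool" where
  "uniformly_differentiable_in F a b f \<longleftrightarrow>
     (\<exists>g \<in> interval_in F a b \<rightarrow> F.
        \<forall>\<epsilon>\<in>positives F. \<exists>\<delta>\<in>positives F. \<forall>x\<in>interval_in F a b. \<forall>y\<in>interval_in F a b.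
          0 < \<bar>x - y\<bar> \<and> \<bar>x - y\<bar> < \<delta> \<longrightarrow> \<bar>diff_quot f y x - g y\<bar> < \<epsilon>)"

end

theory Submission
  imports Defs
begin

text \<open>If \<open>F\<close> is complete then \<open>F = \<real>\<close>, and by the mean value theorem each difference quotient at \<open>y\<close> is a
  value of \<open>f'\<close> near \<open>y\<close>, so uniform continuity of \<open>f'\<close> gives uniform differentiability. If a
  real \<open>r\<close> is missing from \<open>F\<close>, the step function jumping at \<open>r\<close> is locally constant on \<open>F\<close>,
  hence has derivative \<open>0\<close>, but its difference quotients across \<open>r\<close> are unbounded.\<close>

lemma Rats_subset_real_subfield:
  assumes "real_subfield F"
  shows "\<rat> \<subseteq> F"
proof
  have add: "x + y \<in> F" and mult: "x * y \<in> F" if "x \<in> F" "y \<in> F" for x y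
    using assms that unfolding real_subfield_def by blast+
  have nat: "of_nat n \<in> F" for n
    by (induction n) (use assms add in \<open>auto simp: real_subfield_def\<close>)
  have int: "of_int k \<in> F" for k
  proof (cases k)
    case (neg n)
    then show ?thesis
      using assms nat[of "Suc n"] unfolding real_subfield_def
      by (metis of_int_minus of_int_of_nat_eq)
  qed (use nat in simp)
  fix x :: real
  assume "x \<in> \<rat>"
  then obtain p q where pq: "q > 0" "x = of_int p / of_int q"
    by (auto elim: Rats_cases')
  have "inverse (of_int q) \<in> F"
    using assms int[of q] pq(1) unfolding real_subfield_def by force
  then show "x \<in> F"
    using mult[OF int] pq(2) by (simp add: divide_inverse)
qed

text \<open>Density is inherited from the rationals contained in \<open>F\<close>. It supplies the
  points, radii and tolerances that later proofs must take inside \<open>F\<close>.\<close>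

lemma real_subfield_dense:
  assumes "real_subfield F" "x < y"
  obtains z where "z \<in> F" "x < z" "z < y"
  using Rats_dense_in_real[OF assms(2)] Rats_subset_real_subfield[OF assms(1)] by blast

text \<open>For a real \<open>r\<close>, let \<open>s\<close> be the supremum in \<open>F\<close> of
  the elements of \<open>F\<close> below \<open>r\<close>. By density, \<open>s < r\<close> would
  leave such an element above \<open>s\<close>, and \<open>r < s\<close> would yield a smaller upper
  bound in \<open>F\<close>, so \<open>r = s\<close>.\<close>

lemma order_complete_iff_UNIV:
  assumes "real_subfield F"
  shows "order_complete F \<longleftrightarrow> F = UNIV"
proof
  assume complete: "order_complete F"
  have "r \<in> F" for r
  proof -
    let ?S = "{q \<in> F. q < r}"
    have "?S \<noteq> {}"
      using real_subfield_dense[OF assms, of "r - 1" r] by force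
    moreover obtain u where "u \<in> F" "r < u"
      using real_subfield_dense[OF assms, of r "r + 1"] by auto
    then have "upper_bound_in F ?S u"
      unfolding upper_bound_in_def by auto
    ultimately obtain s where s: "supremum_in F ?S s"
      using complete[unfolded order_complete_def, rule_format, of ?S] by blast
    then have s_in: "s \<in> F" and s_ub: "\<And>x. x \<in> F \<Longrightarrow> x < r \<Longrightarrow> x \<le> s"
      and s_least: "\<And>u. u \<in> F \<Longrightarrow> (\<And>x. x \<in> F \<Longrightarrow> x < r \<Longrightarrow> x \<le> u) \<Longrightarrow> s \<le> u"
      unfolding supremum_in_def upper_bound_in_def by auto
    have "\<not> s < r"
    proof
      assume "s < r"
      then obtain z where "z \<in> F" "s < z" "z < r"
        using real_subfield_dense[OF assms] by blast
      then show False
        using s_ub[of z] by linarith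
    qed
    moreover have "\<not> r < s"
    proof
      assume "r < s"
      then obtain z where "z \<in> F" "r < z" "z < s"
        using real_subfield_dense[OF assms] by blast
      then show False
        using s_least[of z] by force
    qed
    ultimately show "r \<in> F"
      using s_in by (metis linorder_neqE)
  qed
  then show "F = UNIV" by blast
next
  assume F: "F = UNIV"
  show "order_complete F"
    unfolding order_complete_def
  proof (intro allI impI)
    fix S
    assume "S \<subseteq> F \<and> S \<noteq> {} \<and> (\<exists>u. upper_bound_in F S u)"
    then have "S \<noteq> {}" "bdd_above S"
      unfolding upper_bound_in_def bdd_above_def by auto
    then have "supremum_in F S (Sup S)"
      unfolding supremum_in_def upper_bound_in_def F by (auto intro: cSup_upper cSup_least)
    then show "\<exists>s. supremum_in F S s" by blast
  qed
qed

text \<open>This opens the way to the calculus of the library, in particular to the mean value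
  theorem.\<close>

lemma has_derivative_in_UNIV_iff:
  "has_derivative_in UNIV a b f c m \<longleftrightarrow> (f has_real_derivative m) (at c within {a..b})"
  unfolding has_derivative_in_def has_field_derivative_iff tendsto_iff eventually_at
    positives_def interval_in_def diff_quot_def dist_real_def
  by (auto simp: Ball_def Bex_def)

lemma diff_quot_commute: "diff_quot f x y = diff_quot f y x"
  unfolding diff_quot_def by (metis minus_diff_eq minus_divide_divide)

lemma diff_quot_mvt:
  assumes deriv: "\<And>c. c \<in> {a..b} \<Longrightarrow> (f has_real_derivative f' c) (at c within {a..b})"
    and "a \<le> x" "x < y" "y \<le> b"
  obtains z where "x < z" "z < y" "diff_quot f x y = f' z"
proof -
  have "continuous_on {x..y} f"
    by (rule continuous_on_subset[OF DERIV_continuous_on[OF deriv]]) (use assms(2,4) in auto)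
  \<comment> \<open>Such a \<open>z\<close> is interior to \<open>{a..b}\<close>, where the
    derivative within the interval is the ordinary one; at the endpoints only continuity is
    required.\<close>
  moreover have "(f has_derivative (*) (f' z)) (at z)" if "x < z" "z < y" for z
    using deriv[of z] that assms(2,4)
    by (simp add: at_within_Icc_at has_field_derivative_def)
  ultimately obtain z where "x < z" "z < y" "f y - f x = f' z * (y - x)"
    using mvt[OF \<open>x < y\<close>, of f "\<lambda>z. (*) (f' z)"] by blast
  then show thesis
    using that \<open>x < y\<close> by (simp add: diff_quot_def)
qed

lemma uniformly_differentiable_in_UNIV:
  assumes deriv: "\<And>c. c \<in> interval_in UNIV a b \<Longrightarrow> has_derivative_in UNIV a b f c (f' c)"
    and cont: "uniformly_continuous_in UNIV a b f'"
  shows "uniformly_differentiable_in UNIV a b f"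
  unfolding uniformly_differentiable_in_def
proof (intro bexI[of _ f'] ballI)
  fix \<epsilon> :: real
  assume "\<epsilon> \<in> positives UNIV"
  then obtain \<delta> where \<delta>: "\<delta> \<in> positives UNIV"
    and close: "\<And>x y. x \<in> {a..b} \<Longrightarrow> y \<in> {a..b} \<Longrightarrow> \<bar>x - y\<bar> < \<delta> \<Longrightarrow> \<bar>f' x - f' y\<bar> < \<epsilon>"
    using cont unfolding uniformly_continuous_in_def interval_in_def by auto
  have deriv': "(f has_real_derivative f' c) (at c within {a..b})" if "c \<in> {a..b}" for c
    using deriv[of c] that by (simp add: has_derivative_in_UNIV_iff interval_in_def)
  have "\<bar>diff_quot f y x - f' y\<bar> < \<epsilon>"
    if xy: "x \<in> {a..b}" "y \<in> {a..b}" "0 < \<bar>x - y\<bar>" "\<bar>x - y\<bar> < \<delta>" for x y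
  proof -
    have "\<exists>z\<in>{a..b}. \<bar>z - y\<bar> < \<delta> \<and> diff_quot f y x = f' z"
    \<comment> \<open>The mean value theorem needs the smaller point first; the symmetry of
      \<open>diff_quot\<close> covers the other order.\<close>
    proof (cases "x < y")
      case True
      obtain z where "x < z" "z < y" "diff_quot f x y = f' z"
        by (rule diff_quot_mvt[of a b f f' x y]) (use deriv' xy True in auto)
      then show ?thesis
        using xy by (intro bexI[of _ z]) (auto simp: diff_quot_commute[of f y])
    next
      case False
      obtain z where "y < z" "z < x" "diff_quot f y x = f' z"
        by (rule diff_quot_mvt[of a b f f' y x]) (use deriv' xy False in auto)
      then show ?thesis
        using xy by (intro bexI[of _ z]) auto
    qed
    then show ?thesis
      using close xy(2) by auto
  qed
  then show "\<exists>\<delta>\<in>positives UNIV. \<forall>x\<in>interval_in UNIV a b. \<forall>y\<in>interval_in UNIV a b.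
      0 < \<bar>x - y\<bar> \<and> \<bar>x - y\<bar> < \<delta> \<longrightarrow> \<bar>diff_quot f y x - f' y\<bar> < \<epsilon>"
    using \<delta> by (intro bexI[of _ \<delta>]) (auto simp: interval_in_def)
qed simp

lemma step_has_derivative_in:
  assumes F: "real_subfield F" and "c \<in> F" "r \<notin> F"
  shows "has_derivative_in F a b (\<lambda>x. if x < r then 0 else 1) c 0"
proof -
  have "0 < \<bar>c - r\<bar>"
    using assms(2,3) by auto
  then obtain d where d: "d \<in> F" "0 < d" "d < \<bar>c - r\<bar>"
    using real_subfield_dense[OF F] by blast
  \<comment> \<open>Since \<open>d < \<bar>c - r\<bar>\<close>, the points \<open>x\<close> and
    \<open>c\<close> lie on the same side of \<open>r\<close>. The numerator is then exactly 0, so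
    one radius serves every \<open>\<epsilon>\<close>.\<close>
  have "\<bar>diff_quot (\<lambda>x. if x < r then 0 else 1) c x - 0\<bar> < \<epsilon>"
    if "0 < \<epsilon>" "\<bar>x - c\<bar> < d" for x \<epsilon> :: real
    using that d by (auto simp: diff_quot_def)
  then show ?thesis
    using d F unfolding has_derivative_in_def positives_def real_subfield_def by fastforce
qed

text \<open>Nothing is known about the candidate derivative \<open>g\<close>, so two quotients based
  at the same \<open>y\<close> just below \<open>r\<close> are compared: one to a point
  \<open>z\<close> still below \<open>r\<close>, one to a point \<open>x\<close> above it. Both are
  within \<open>e < 1/2\<close> of \<open>g y\<close>, hence less than 1 apart, yet they are 0 and
  \<open>1 / (x - y)\<close>.\<close>

lemma step_not_uniformly_differentiable_in:
  assumes F: "real_subfield F" and "a < r" "r < b"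
  shows "\<not> uniformly_differentiable_in F a b (\<lambda>x. if x < r then 0 else 1)"
proof
  let ?f = "\<lambda>x::real. if x < r then 0 else (1::real)"
  assume "uniformly_differentiable_in F a b ?f"
  moreover obtain e where e: "e \<in> F" "0 < e" "e < (1/2 :: real)"
    using real_subfield_dense[OF F, of 0 "1/2"] by auto
  ultimately obtain g d where d: "0 < d"
    and close: "\<And>x y. x \<in> interval_in F a b \<Longrightarrow> y \<in> interval_in F a b \<Longrightarrow> 0 < \<bar>x - y\<bar> \<Longrightarrow>
        \<bar>x - y\<bar> < d \<Longrightarrow> \<bar>diff_quot ?f y x - g y\<bar> < e"
    unfolding uniformly_differentiable_in_def positives_def by blast
  \<comment> \<open>With \<open>x\<close> and \<open>y\<close> both within \<open>h\<close> of
    \<open>r\<close>, their distance is below \<open>2 * h\<close>: at most \<open>d\<close>, so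
    that \<open>close\<close> applies, and at most 1, so that the quotient across the jump exceeds
    1.\<close>
  define h where "h = min d 1 / 2"
  have h: "0 < h" "2 * h \<le> d" "2 * h \<le> 1"
    using d by (auto simp: h_def)
  obtain y where y: "y \<in> F" "max a (r - h) < y" "y < r"
    using real_subfield_dense[OF F, of "max a (r - h)" r] assms h by auto
  obtain z where z: "z \<in> F" "y < z" "z < r"
    using real_subfield_dense[OF F y(3)] by auto
  obtain x where x: "x \<in> F" "r < x" "x < min b (r + h)"
    using real_subfield_dense[OF F, of r "min b (r + h)"] assms h by auto
  have "\<bar>diff_quot ?f y z - g y\<bar> < e"
    by (rule close) (use assms h x y z in \<open>auto simp: interval_in_def\<close>)
  moreover have "\<bar>diff_quot ?f y x - g y\<bar> < e"
    by (rule close) (use assms h x y z in \<open>auto simp: interval_in_def\<close>)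
  moreover have "diff_quot ?f y z = 0" "diff_quot ?f y x = 1 / (x - y)"
    using x y z by (auto simp: diff_quot_def)
  moreover have "1 / (x - y) > 1"
    using x y h by (simp add: field_simps)
  ultimately show False
    using e by linarith
qed

theorem theorem3:
  fixes F :: "real set"
  assumes "real_subfield F"
  shows "order_complete F \<longleftrightarrow>
    (\<forall>a\<in>F. \<forall>b\<in>F. a < b \<longrightarrow>
      (\<forall>f \<in> interval_in F a b \<rightarrow> F. \<forall>f' \<in> interval_in F a b \<rightarrow> F.
         (\<forall>c\<in>interval_in F a b. has_derivative_in F a b f c (f' c)) \<and>
         uniformly_continuous_in F a b f' \<longrightarrow>
         uniformly_differentiable_in F a b f))"
proof -
  \<comment> \<open>A gap \<open>r\<close> refutes the right-hand side: the step at
    \<open>r\<close>, on an interval around \<open>r\<close> with endpoints in \<open>F\<close>, has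
    the uniformly continuous derivative 0.\<close>
  have "\<exists>a\<in>F. \<exists>b\<in>F. a < b \<and> (\<exists>f \<in> interval_in F a b \<rightarrow> F. \<exists>f' \<in> interval_in F a b \<rightarrow> F.
      (\<forall>c\<in>interval_in F a b. has_derivative_in F a b f c (f' c)) \<and>
      uniformly_continuous_in F a b f' \<and> \<not> uniformly_differentiable_in F a b f)"
    if r: "r \<notin> F" for r
  proof -
    obtain a where a: "a \<in> F" "a < r"
      using real_subfield_dense[OF assms, of "r - 1" r] by auto
    obtain b where b: "b \<in> F" "r < b"
      using real_subfield_dense[OF assms, of r "r + 1"] by auto
    have F: "0 \<in> F" "1 \<in> F"
      using assms by (auto simp: real_subfield_def)
    have "uniformly_continuous_in F a b (\<lambda>_. 0)"
      using F by (auto simp: uniformly_continuous_in_def positives_def)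
    then show ?thesis
      using a b F r
      by (intro bexI[of _ a] bexI[of _ b] conjI bexI[of _ "\<lambda>x. if x < r then 0 else 1"]
          bexI[of _ "\<lambda>_. 0"] ballI step_has_derivative_in[OF assms]
          step_not_uniformly_differentiable_in[OF assms])
        (auto simp: interval_in_def)
  qed
  then show ?thesis
    using order_complete_iff_UNIV[OF assms] uniformly_differentiable_in_UNIV by blast
qed

end
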